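(* Let $r\ge 1$ be an integer. For all $k_1,\ldots,k_r\in\mathbb{Z}$ and $m_1,\ldots,m_r\in\mathbb{Z}_{\ge 0}$, $$ \mathbb{B}_{m_1,\ldots,m_r}^{(k_1,\ldots,k_r)}=(-1)^{m_1+\cdots+m_r}\sum_{\ell_1,\ldots,\ell_r=0}^{m_1+\cdots+m_r}\frac{(-1)^{\ell_1+\cdots+\ell_r}\,\ell_1!\cdots\ell_r!}{(\ell_1+1)^{k_1}(\ell_1+\ell_2+2)^{k_2}\cdots(\ell_1+\cdots+\ell_r+r)^{k_r}} \sum_{(n_{i,j})}\ \prod_{i=1}^{r-1}\binom{m_{i+1}}{n_{i,1},\ldots,n_{i,i+1}}\ \prod_{j=1}^{r}{m_j-\sum_{i=1}^{j-1}n_{j-1,i}+\sum_{i=j}^{r-1}n_{i,j}\brace \ell_j}, $$ where each $\ell_j$ ranges independently over $0,1,\ldots,m_1+\cdots+m_r$, and the inner sum runs over all families of nonnegative integers $(n_{i,j})_{1\le i\le r-1,\ 1\le j\le i+1}$ such that $n_{i,1}+\cdots+n_{i,i+1}=m_{i+1}$ for every $1\le i\le r-1$.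
   Context: Stirling numbers of the second kind ${m\brace \ell}$ are defined by ${0\brace 0}=1$, ${m\brace 0}={0\brace \ell}=0$ for $m,\ell\neq 0$, and ${m+1\brace \ell}={m\brace \ell-1}+\ell{m\brace \ell}$; in particular ${m\brace \ell}=0$ when $\ell>m$. The multinomial coefficient is $\binom{m}{n_1,\ldots,n_p}=\frac{m!}{n_1!\cdots n_p!}$ for nonnegative integers with $n_1+\cdots+n_p=m$. Empty sums are $0$ and empty products are $1$; for $r=1$ there are no $n_{i,j}$ and the inner sum consists of the single term ${m_1\brace \ell_1}$. The multiple polylogarithm of shuffle type is $$\mathrm{Li}^{\mathrm{sh}}_{s_1,\ldots,s_r}(z_1,\ldots,z_r)=\sum_{0<p_1<\cdots<p_r}\frac{z_1^{p_1}z_2^{p_2-p_1}\cdots z_r^{p_r-p_{r-1}}}{p_1^{s_1}p_2^{s_2}\cdots p_r^{s_r}}.$$ The multi-indexed poly-Bernoulli numbers $\mathbb{B}_{m_1,\ldots,m_r}^{(k_1,\ldots,k_r)}$ (for $k_i\in\mathbb{Z}$, $m_i\in\mathbb{Z}_{\ge0}$) are defined by the power series expansion in $t_1,\ldots,t_r$ $$\frac{\mathrm{Li}^{\mathrm{sh}}_{k_1,\ldots,k_r}\left(1-e^{-\sum_{v=1}^r t_v},\ldots,1-e^{-t_{r-1}-t_r},1-e^{-t_r}\right)}{\prod_{j=1}^r\left(1-e^{-\sum_{v=j}^r t_v}\right)}=\sum_{m_1,\ldots,m_r=0}^\infty\mathbb{B}_{m_1,\ldots,m_r}^{(k_1,\ldots,k_r)}\frac{t_1^{m_1}\cdots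 t_r^{m_r}}{m_1!\cdots m_r!},$$ where the $j$-th argument of $\mathrm{Li}^{\mathrm{sh}}$ is $1-e^{-\sum_{v=j}^r t_v}$. *)

theory Defs
  imports "HOL-Analysis.Analysis" "HOL-Combinatorics.Stirling"
begin

text \<open>
  An \<open>r\<close>-tuple is a function on \<open>nat\<close> of which only the values at \<open>1, \<dots>, r\<close> matter.
  Where tuples are summed over, they are taken from an extensional function space over
  \<open>{1..r}\<close>, so that each tuple is counted exactly once.
\<close>

definition increasing_tuples :: "nat \<Rightarrow> (nat \<Rightarrow> nat) set" where
  "increasing_tuples r = {p \<in> {1..r} \<rightarrow>\<^sub>E {0<..}. strict_mono_on {1..r} p}"

text \<open>
  The exponent of the first variable is \<open>p 1\<close>; it is split off because \<open>p 0\<close> is not a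
  meaningful value of an extensional tuple.
\<close>

definition Li_sh :: "nat \<Rightarrow> (nat \<Rightarrow> int) \<Rightarrow> (nat \<Rightarrow> complex) \<Rightarrow> complex" where
  "Li_sh r s z =
     (\<Sum>\<^sub>\<infinity>p\<in>increasing_tuples r.
        (\<Prod>j=1..r. z j ^ (if j = 1 then p 1 else p j - p (j - 1)))
          / (\<Prod>j=1..r. of_nat (p j) powi s j))"

definition multi_indices :: "nat \<Rightarrow> (nat \<Rightarrow> nat) set" where
  "multi_indices r = {1..r} \<rightarrow>\<^sub>E UNIV"

definition one_minus_exp :: "nat \<Rightarrow> (nat \<Rightarrow> complex) \<Rightarrow> nat \<Rightarrow> complex" where
  "one_minus_exp r t j = 1 - exp (- (\<Sum>v=j..r. t v))"

text \<open>
  \<open>B\<close> is a family of coefficients of the exponential power series at the origin of the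
  generating function. The quotient is defined only where no factor of its denominator
  vanishes, so the expansion is required at exactly those points of some polydisc around the
  origin; they are dense in it, hence the coefficients are determined.
\<close>

definition poly_bernoulli_expansion ::
    "nat \<Rightarrow> (nat \<Rightarrow> int) \<Rightarrow> ((nat \<Rightarrow> nat) \<Rightarrow> complex) \<Rightarrow> bool" where
  "poly_bernoulli_expansion r k B \<longleftrightarrow>
     (\<exists>\<epsilon>>0. \<forall>t. (\<forall>j\<in>{1..r}. norm (t j) < \<epsilon> \<and> one_minus_exp r t j \<noteq> 0) \<longrightarrow>
        ((\<lambda>m. B m * (\<Prod>j=1..r. t j ^ m j / fact (m j))) has_sum
           (Li_sh r k (one_minus_exp r t) / (\<Prod>j=1..r. one_minus_exp r t j)))
        (multi_indices r))"

definition poly_bernoulli :: "nat \<Rightarrow> (nat \<Rightarrow> int) \<Rightarrow> (nat \<Rightarrow> nat) \<Rightarrow> complex" where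
  "poly_bernoulli r k m =
     (THE B. B \<in> extensional (multi_indices r) \<and> poly_bernoulli_expansion r k B)
       (restrict m {1..r})"

text \<open>The multinomial coefficient with top entry \<open>m\<close> and bottom entries \<open>n i\<close> for \<open>i \<in> I\<close>.\<close>

definition multinomial :: "nat \<Rightarrow> 'a set \<Rightarrow> ('a \<Rightarrow> nat) \<Rightarrow> complex" where
  "multinomial m I n = fact m / (\<Prod>i\<in>I. fact (n i))"

text \<open>
  The families \<open>(n i j)\<close> with \<open>1 \<le> i \<le> r - 1\<close> and \<open>1 \<le> j \<le> i + 1\<close> whose \<open>i\<close>-th row sums
  to \<open>m (i + 1)\<close>, as functions of the pair \<open>(i, j)\<close>.
\<close>

definition row_families :: "nat \<Rightarrow> (nat \<Rightarrow> nat) \<Rightarrow> (nat \<times> nat \<Rightarrow> nat) set" where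
  "row_families r m =
     {n \<in> (SIGMA i:{1..<r}. {1..i + 1}) \<rightarrow>\<^sub>E UNIV.
        \<forall>i\<in>{1..<r}. (\<Sum>j=1..i + 1. n (i, j)) = m (i + 1)}"

text \<open>
  The first argument of the Stirling number attached to \<open>j\<close>. The subtraction does not truncate
  on \<open>row_families r m\<close>: for \<open>j = 1\<close> nothing is subtracted, and for \<open>j \<ge> 2\<close> the subtracted sum
  is part of row \<open>j - 1\<close>, whose total is \<open>m j\<close>.
\<close>

definition stirling_top :: "nat \<Rightarrow> (nat \<Rightarrow> nat) \<Rightarrow> (nat \<times> nat \<Rightarrow> nat) \<Rightarrow> nat \<Rightarrow> nat" where
  "stirling_top r m n j =
     m j - (\<Sum>i\<in>{1..<j}. n (j - 1, i)) + (\<Sum>i\<in>{j..<r}. n (i, j))"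

end

theory Submission
  imports Defs "HOL-Complex_Analysis.Cauchy_Integral_Formula"
begin

text \<open>
  Write \<open>w\<^sub>j = t\<^sub>j + \<dots> + t\<^sub>r\<close> and \<open>z\<^sub>j = 1 - exp (- w\<^sub>j)\<close>. Encode an increasing tuple
  \<open>p\<close> by its gaps, \<open>p\<^sub>j = l\<^sub>1 + \<dots> + l\<^sub>j + j\<close> with \<open>l\<^sub>i \<ge> 0\<close>. Then every \<open>z\<^sub>j\<close> occurs in the
  polylogarithm with exponent \<open>l\<^sub>j + 1\<close>, so division by the product of the \<open>z\<^sub>j\<close> leaves the sum over
  all \<open>l\<close> of \<open>z\<^sub>1^l\<^sub>1 \<dots> z\<^sub>r^l\<^sub>r\<close> divided by the product of the
  \<open>p\<^sub>j powi k\<^sub>j\<close> (\<open>Li_sh_eq_gap_sum\<close>).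

  Each power is expanded by the exponential generating function of the Stirling numbers,
  \<open>(1 - exp (- w)) ^ l = (\<Sum>q. (-1) ^ (l + q) * l! * Stirling q l * w ^ q / q!)\<close>
  (\<open>one_minus_exp_power_has_sum\<close>), and each \<open>w\<^sub>j ^ q / q!\<close> by the multinomial theorem, which
  distributes \<open>q\<close> over the variables \<open>t\<^sub>j, \<dots>, t\<^sub>r\<close> (\<open>has_sum_multinomial_expansion\<close>). All these
  distributions together form a triangular array of exponents, whose row sums are the upper entries of
  the Stirling numbers and whose column sums are the exponents \<open>m\<close> of the resulting monomial. For
  given column sums, the columns other than the first, which is a single entry, are the
  rows of the families \<open>n\<close> in the formula (\<open>bij_betw_array_of_family\<close>), and the factorials in each
  column combine to a multinomial coefficient (\<open>column_fibre_monomial\<close>). Since the rows of the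
  array have sums at most \<open>m\<^sub>1 + \<dots> + m\<^sub>r\<close>, only finitely many \<open>l\<close> contribute.

  The rearrangement from sums over \<open>l\<close> to sums over \<open>m\<close> is justified by absolute convergence.
  The norms of the expansion of \<open>z\<^sub>j ^ l\<^sub>j\<close> add up to \<open>(exp W\<^sub>j - 1) ^ l\<^sub>j\<close>, where
  \<open>W\<^sub>j = \<bar>t\<^sub>j\<bar> + \<dots> + \<bar>t\<^sub>r\<bar>\<close>, and the reciprocal of the product of the \<open>p\<^sub>j powi k\<^sub>j\<close> is at most a
  constant times \<open>exp (l\<^sub>1 + \<dots> + l\<^sub>r)\<close>; so near the origin the sum over \<open>l\<close> is dominated by a product
  of geometric series (\<open>Li_sh_quotient_has_sum\<close>). Finally, the numbers are defined as the coefficients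
  of the expansion, so that an expansion is decisive only because its coefficients are
  unique (\<open>poly_bernoulli_expansion_unique\<close>): two coefficient families with the same sums agree already
  when the sums agree at all small positive real arguments.
\<close>

section \<open>Powers of \<open>1 - exp (- x)\<close> and Stirling numbers\<close>

text \<open>
  The right-hand side is the inclusion--exclusion count of surjections. It satisfies the recurrence
  of the left-hand side because \<open>k (l choose k) = l ((l choose k) - (l - 1 choose k))\<close>.
\<close>

lemma fact_mult_Stirling_eq_alternating_sum:
  "fact l * of_nat (Stirling q l) =
     (\<Sum>k\<le>l. (-1) ^ (l - k) * of_nat (l choose k) * (of_nat k ^ q :: 'a :: field_char_0))"
proof (induction q arbitrary: l)
  case 0
  have "(\<Sum>k\<le>l. (-1) ^ (l - k) * of_nat (l choose k) :: 'a) = (1 + (-1)) ^ l"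
    by (subst binomial_ring) (simp add: mult_ac)
  also have "\<dots> = fact l * of_nat (Stirling 0 l)"
    by (cases l) auto
  finally show ?case by simp
next
  case (Suc q)
  show ?case
  proof (cases l)
    case 0
    then show ?thesis by simp
  next
    case l: (Suc n)
    have absorb: "of_nat k * of_nat (l choose k) =
        (of_nat l * (of_nat (l choose k) - of_nat (n choose k)) :: 'a)" for k
    proof (cases k)
      case (Suc i)
      have "k * (l choose k) = l * (n choose i)"
        using Suc_times_binomial_eq[of n i] by (simp add: l Suc mult.commute)
      moreover have "l choose k = (n choose i) + (n choose k)"
        by (simp add: l Suc)
      ultimately show ?thesis
        by (metis add_diff_cancel_right' of_nat_add of_nat_mult)
    qed auto
    have neg: "(\<Sum>k\<le>l. (-1) ^ (l - k) * of_nat (n choose k) * (of_nat k ^ q :: 'a)) =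
        - (\<Sum>k\<le>n. (-1) ^ (n - k) * of_nat (n choose k) * of_nat k ^ q)"
      by (auto simp: l binomial_eq_0 sum_negf[symmetric] Suc_diff_le intro!: sum.cong)
    have "(\<Sum>k\<le>l. (-1) ^ (l - k) * of_nat (l choose k) * (of_nat k ^ Suc q :: 'a)) =
        (\<Sum>k\<le>l. (-1) ^ (l - k) * of_nat k ^ q * (of_nat k * of_nat (l choose k)))"
      by (simp add: mult_ac)
    also have "\<dots> = of_nat l *
        ((\<Sum>k\<le>l. (-1) ^ (l - k) * of_nat (l choose k) * of_nat k ^ q) -
         (\<Sum>k\<le>l. (-1) ^ (l - k) * of_nat (n choose k) * of_nat k ^ q))"
      unfolding absorb by (simp add: sum_subtractf[symmetric] sum_distrib_left algebra_simps)
    also have "\<dots> = of_nat l * (fact l * of_nat (Stirling q l) + fact n * of_nat (Stirling q n))"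
      unfolding neg using Suc.IH[of l] Suc.IH[of n] by simp
    also have "\<dots> = fact l * of_nat (Stirling (Suc q) l)"
      by (simp add: l algebra_simps)
    finally show ?thesis by simp
  qed
qed

text \<open>
  Summed against \<open>x ^ q / q!\<close>, the alternating sum of the powers \<open>k ^ q\<close> turns into an alternating
  sum of the exponentials \<open>exp (k x)\<close>, which the binomial theorem collapses.
\<close>

lemma sums_Stirling_exponential:
  fixes x :: "'a :: {real_normed_field, banach}"
  shows "(\<lambda>q. fact l * of_nat (Stirling q l) * x ^ q / fact q) sums (exp x - 1) ^ l"
proof -
  have "(\<lambda>q. \<Sum>k\<le>l. (-1) ^ (l - k) * of_nat (l choose k) * ((of_nat k * x) ^ q /\<^sub>R fact q)) sums
      (\<Sum>k\<le>l. (-1) ^ (l - k) * of_nat (l choose k) * exp (of_nat k * x))"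
    by (intro sums_sum sums_mult exp_converges)
  also have "(\<Sum>k\<le>l. (-1) ^ (l - k) * of_nat (l choose k) * exp (of_nat k * x)) = (exp x - 1) ^ l"
    unfolding diff_conv_add_uminus
    by (subst binomial_ring) (simp add: exp_of_nat2_mult mult_ac)
  also have "(\<lambda>q. \<Sum>k\<le>l. (-1) ^ (l - k) * of_nat (l choose k) * ((of_nat k * x) ^ q /\<^sub>R fact q)) =
      (\<lambda>q. fact l * of_nat (Stirling q l) * x ^ q / fact q)"
    unfolding fact_mult_Stirling_eq_alternating_sum
    by (simp add: sum_distrib_right sum_distrib_left power_mult_distrib scaleR_conv_of_real
          divide_inverse mult_ac)
  finally show ?thesis .
qed

text \<open>
  The coefficients of the exponential power series of \<open>(1 - exp (- x)) ^ l\<close>.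
\<close>

definition one_minus_exp_coeff :: "nat \<Rightarrow> nat \<Rightarrow> 'a :: real_normed_field" where
  "one_minus_exp_coeff l q = (-1) ^ (l + q) * fact l * of_nat (Stirling q l)"

text \<open>
  Taking absolute values of the coefficients removes the signs, so the dominating series sums to
  \<open>(exp x - 1) ^ l\<close>. Knowing this value exactly is what makes the later convergence
  estimate geometric in \<open>l\<close>.
\<close>

lemma one_minus_exp_power_norm_has_sum:
  fixes x :: real
  assumes "x \<ge> 0"
  shows "((\<lambda>q. norm (one_minus_exp_coeff l q :: 'a :: real_normed_field) * x ^ q / fact q) has_sum
           (exp x - 1) ^ l) UNIV"
proof -
  have "(\<lambda>q. fact l * of_nat (Stirling q l) * x ^ q / fact q) sums (exp x - 1) ^ l"
    by (rule sums_Stirling_exponential)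
  then have "((\<lambda>q. fact l * of_nat (Stirling q l) * x ^ q / fact q) has_sum (exp x - 1) ^ l) UNIV"
    using assms by (intro norm_summable_imp_has_sum) (auto simp: sums_iff)
  then show ?thesis
    by (simp add: one_minus_exp_coeff_def norm_mult norm_power)
qed

lemma one_minus_exp_power_has_sum:
  fixes x :: "'a :: {real_normed_field, banach}"
  shows "((\<lambda>q. one_minus_exp_coeff l q * x ^ q / fact q) has_sum (1 - exp (- x)) ^ l) UNIV"
proof (rule norm_summable_imp_has_sum)
  have "(\<lambda>q. (-1) ^ l * (fact l * of_nat (Stirling q l) * (- x) ^ q / fact q)) sums
      ((-1) ^ l * (exp (- x) - 1) ^ l)"
    by (intro sums_mult sums_Stirling_exponential)
  also have "(-1) ^ l * (exp (- x) - 1) ^ l = (1 - exp (- x)) ^ l"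
    by (simp add: power_mult_distrib[symmetric])
  also have "(\<lambda>q. (-1) ^ l * (fact l * of_nat (Stirling q l) * (- x) ^ q / fact q)) =
      (\<lambda>q. one_minus_exp_coeff l q * x ^ q / fact q)"
    by (simp add: one_minus_exp_coeff_def power_add power_minus[of x] mult_ac)
  finally show "(\<lambda>q. one_minus_exp_coeff l q * x ^ q / fact q) sums (1 - exp (- x)) ^ l" .
  have "summable (\<lambda>q. norm (one_minus_exp_coeff l q :: 'a) * norm x ^ q / fact q)"
    using one_minus_exp_power_norm_has_sum[of "norm x" l, where ?'a = 'a]
    by (auto dest!: has_sum_imp_sums simp: sums_iff)
  then show "summable (\<lambda>q. norm (one_minus_exp_coeff l q * x ^ q / fact q))"
    by (simp add: norm_mult norm_divide norm_power)
qed

section \<open>Series over multi-indices\<close>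

lemma bij_betw_PiE_insert:
  assumes "x \<notin> I"
  shows "bij_betw (\<lambda>(n, a). a(x := n)) (B x \<times> PiE I B) (PiE (insert x I) B)"
proof (rule bij_betwI[where g = "\<lambda>a. (a x, a(x := undefined))"])
  show "(\<lambda>(n, a). a(x := n)) \<in> B x \<times> PiE I B \<rightarrow> PiE (insert x I) B"
    by (auto simp: PiE_def extensional_def)
  show "(\<lambda>a. (a x, a(x := undefined))) \<in> PiE (insert x I) B \<rightarrow> B x \<times> PiE I B"
    using assms by (auto simp: PiE_def extensional_def)
qed (use assms in \<open>auto simp: PiE_def extensional_def fun_eq_iff\<close>)

lemma prod_fun_upd_notin: "x \<notin> I \<Longrightarrow> (\<Prod>v\<in>I. g v ((a(x := n)) v)) = (\<Prod>v\<in>I. g v (a v))"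
  by (intro prod.cong) auto

definition compositions :: "'i set \<Rightarrow> nat \<Rightarrow> ('i \<Rightarrow> nat) set" where
  "compositions I q = {a \<in> I \<rightarrow>\<^sub>E UNIV. (\<Sum>v\<in>I. a v) = q}"

lemma finite_compositions:
  assumes "finite I"
  shows "finite (compositions I q)"
proof (rule finite_subset)
  show "compositions I q \<subseteq> I \<rightarrow>\<^sub>E {..q}"
    using assms by (auto simp: compositions_def PiE_def Pi_def intro: member_le_sum)
  show "finite (I \<rightarrow>\<^sub>E {..q})"
    using assms by (intro finite_PiE) auto
qed

text \<open>
  The induction over \<open>I\<close> peels off one exponent at a time by the binomial theorem. With the
  factorials divided out, the multinomial coefficients disappear from the statement.
\<close>

lemma multinomial_theorem_divided_powers:
  fixes t :: "'i \<Rightarrow> 'a :: field_char_0"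
  assumes "finite I"
  shows "(\<Sum>v\<in>I. t v) ^ q / fact q = (\<Sum>a\<in>compositions I q. \<Prod>v\<in>I. t v ^ a v / fact (a v))"
  using assms
proof (induction I arbitrary: q)
  case empty
  have "compositions ({} :: 'i set) q = (if q = 0 then {\<lambda>_. undefined} else {})"
    by (auto simp: compositions_def)
  then show ?case by auto
next
  case (insert x I)
  have [simp]: "(\<Sum>v\<in>I. if v = x then n else a v) = (\<Sum>v\<in>I. a v)" for n and a :: "'i \<Rightarrow> nat"
    using insert.hyps by (intro sum.cong) auto
  have bij: "bij_betw (\<lambda>(n, a). a(x := n)) (SIGMA n:{..q}. compositions I (q - n))
      (compositions (insert x I) q)"
  proof (rule bij_betwI[where g = "\<lambda>a. (a x, a(x := undefined))"])
    show "(\<lambda>(n, a). a(x := n)) \<in> (SIGMA n:{..q}. compositions I (q - n))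
        \<rightarrow> compositions (insert x I) q"
      using insert.hyps by (auto simp: compositions_def PiE_def extensional_def)
    show "(\<lambda>a. (a x, a(x := undefined))) \<in> compositions (insert x I) q
        \<rightarrow> (SIGMA n:{..q}. compositions I (q - n))"
      using insert.hyps by (auto simp: compositions_def PiE_def extensional_def)
  qed (use insert.hyps in \<open>auto simp: compositions_def PiE_def extensional_def fun_eq_iff\<close>)
  have "(\<Sum>v\<in>insert x I. t v) ^ q / fact q =
      (\<Sum>n\<le>q. of_nat (q choose n) * t x ^ n * (\<Sum>v\<in>I. t v) ^ (q - n)) / fact q"
    using insert.hyps by (simp add: binomial_ring)
  also have "\<dots> = (\<Sum>n\<le>q. t x ^ n / fact n * ((\<Sum>v\<in>I. t v) ^ (q - n) / fact (q - n)))"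
    unfolding sum_divide_distrib by (intro sum.cong) (auto simp: binomial_fact field_simps)
  also have "\<dots> = (\<Sum>n\<le>q. \<Sum>a\<in>compositions I (q - n).
      t x ^ n / fact n * (\<Prod>v\<in>I. t v ^ a v / fact (a v)))"
    unfolding insert.IH by (simp add: sum_distrib_left)
  also have "\<dots> = (\<Sum>(n, a)\<in>(SIGMA n:{..q}. compositions I (q - n)).
      t x ^ n / fact n * (\<Prod>v\<in>I. t v ^ a v / fact (a v)))"
    using insert.hyps by (subst sum.Sigma) (auto intro: finite_compositions)
  also have "\<dots> = (\<Sum>(n, a)\<in>(SIGMA n:{..q}. compositions I (q - n)).
      \<Prod>v\<in>insert x I. t v ^ (a(x := n)) v / fact ((a(x := n)) v))"
    using insert.hyps
    by (intro sum.cong) (auto simp: prod_fun_upd_notin[where g = "\<lambda>v n. t v ^ n / fact n"] simp del: fun_upd_apply, simp)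
  also have "\<dots> = (\<Sum>a\<in>compositions (insert x I) q. \<Prod>v\<in>insert x I. t v ^ a v / fact (a v))"
    by (subst sum.reindex_bij_betw[OF bij, symmetric]) (simp add: case_prod_unfold)
  finally show ?case .
qed

text \<open>
  Regrouping by the total degree: each composition set is finite and its inner sum is one term of
  the given series, so summability over the pairs is all that is needed.
\<close>

lemma has_sum_multinomial_expansion_aux:
  fixes t :: "'i \<Rightarrow> 'a :: {real_normed_field, banach}"
  assumes "finite I"
    and "((\<lambda>q. h q * (\<Sum>v\<in>I. t v) ^ q / fact q) has_sum S) UNIV"
    and "(\<lambda>(q, a). h q * (\<Prod>v\<in>I. t v ^ a v / fact (a v))) summable_on
           (SIGMA q:UNIV. compositions I q)"
  shows "((\<lambda>a. h (\<Sum>v\<in>I. a v) * (\<Prod>v\<in>I. t v ^ a v / fact (a v))) has_sum S) (I \<rightarrow>\<^sub>E UNIV)"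
proof -
  have "((\<lambda>(q, a). h q * (\<Prod>v\<in>I. t v ^ a v / fact (a v))) has_sum S) (SIGMA q:UNIV. compositions I q)"
  proof (rule has_sum_SigmaI[OF _ assms(2,3)])
    fix q
    have "((\<lambda>a. h q * (\<Prod>v\<in>I. t v ^ a v / fact (a v))) has_sum
        (\<Sum>a\<in>compositions I q. h q * (\<Prod>v\<in>I. t v ^ a v / fact (a v)))) (compositions I q)"
      using assms(1) by (intro has_sum_finite finite_compositions)
    also have "(\<Sum>a\<in>compositions I q. h q * (\<Prod>v\<in>I. t v ^ a v / fact (a v))) =
        h q * (\<Sum>v\<in>I. t v) ^ q / fact q"
      using multinomial_theorem_divided_powers[OF assms(1), of t q]
      by (simp only: sum_distrib_left[symmetric] times_divide_eq_right[symmetric])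
    finally show "((\<lambda>a. (case (q, a) of (q, a) \<Rightarrow> h q * (\<Prod>v\<in>I. t v ^ a v / fact (a v)))) has_sum
        h q * (\<Sum>v\<in>I. t v) ^ q / fact q) (compositions I q)" by simp
  qed
  moreover have "bij_betw (\<lambda>a. (\<Sum>v\<in>I. a v, a)) (I \<rightarrow>\<^sub>E UNIV) (SIGMA q:UNIV. compositions I q)"
    by (rule bij_betwI[where g = snd]) (auto simp: compositions_def)
  ultimately show ?thesis
    using has_sum_reindex_bij_betw[of "\<lambda>a. (\<Sum>v\<in>I. a v, a)" "I \<rightarrow>\<^sub>E UNIV" "SIGMA q:UNIV. compositions I q"
        "\<lambda>(q, a). h q * (\<Prod>v\<in>I. t v ^ a v / fact (a v))" S] by simp
qed

text \<open>
  The case of nonnegative reals supplies the summability: there, iterated summability implies joint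
  summability.
\<close>

lemma has_sum_multinomial_expansion_nonneg:
  fixes t :: "'i \<Rightarrow> real"
  assumes "finite I" and "\<And>q. h q \<ge> 0" and "\<And>v. v \<in> I \<Longrightarrow> t v \<ge> 0"
    and "((\<lambda>q. h q * (\<Sum>v\<in>I. t v) ^ q / fact q) has_sum S) UNIV"
  shows "(\<lambda>(q, a). h q * (\<Prod>v\<in>I. t v ^ a v / fact (a v))) summable_on
           (SIGMA q:UNIV. compositions I q)"
    and "((\<lambda>a. h (\<Sum>v\<in>I. a v) * (\<Prod>v\<in>I. t v ^ a v / fact (a v))) has_sum S) (I \<rightarrow>\<^sub>E UNIV)"
proof -
  show *: "(\<lambda>(q, a). h q * (\<Prod>v\<in>I. t v ^ a v / fact (a v))) summable_on
           (SIGMA q:UNIV. compositions I q)"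
  proof (rule summable_on_SigmaI)
    show "((\<lambda>a. case (q, a) of (q, a) \<Rightarrow> h q * (\<Prod>v\<in>I. t v ^ a v / fact (a v))) has_sum
        h q * (\<Sum>v\<in>I. t v) ^ q / fact q) (compositions I q)" for q
      using multinomial_theorem_divided_powers[OF assms(1), of t q] finite_compositions[OF assms(1)]
      by (intro has_sum_finiteI)
         (simp_all only: sum_distrib_left[symmetric] times_divide_eq_right[symmetric] split)
    show "(\<lambda>q. h q * (\<Sum>v\<in>I. t v) ^ q / fact q) summable_on UNIV"
      using assms(4) by (rule has_sum_imp_summable)
  qed (use assms(2,3) in \<open>auto intro!: mult_nonneg_nonneg prod_nonneg\<close>)
  show "((\<lambda>a. h (\<Sum>v\<in>I. a v) * (\<Prod>v\<in>I. t v ^ a v / fact (a v))) has_sum S) (I \<rightarrow>\<^sub>E UNIV)"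
    by (rule has_sum_multinomial_expansion_aux[OF assms(1,4) *])
qed

text \<open>
  Besides the value of the sum, the sum of the norms is given exactly, so that it can be fed into
  products of such series.
\<close>

lemma has_sum_multinomial_expansion:
  fixes t :: "'i \<Rightarrow> 'a :: {real_normed_field, banach}"
  assumes "finite I"
    and "((\<lambda>q. h q * (\<Sum>v\<in>I. t v) ^ q / fact q) has_sum S) UNIV"
    and "((\<lambda>q. norm (h q) * (\<Sum>v\<in>I. norm (t v)) ^ q / fact q) has_sum S') UNIV"
  shows "((\<lambda>a. h (\<Sum>v\<in>I. a v) * (\<Prod>v\<in>I. t v ^ a v / fact (a v))) has_sum S) (I \<rightarrow>\<^sub>E UNIV)"
    and "((\<lambda>a. norm (h (\<Sum>v\<in>I. a v) * (\<Prod>v\<in>I. t v ^ a v / fact (a v)))) has_sum S') (I \<rightarrow>\<^sub>E UNIV)"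
proof -
  note * = has_sum_multinomial_expansion_nonneg[OF assms(1) _ _ assms(3)]
  have "(\<lambda>x. norm (case x of (q, a) \<Rightarrow> h q * (\<Prod>v\<in>I. t v ^ a v / fact (a v)))) summable_on
           (SIGMA q:UNIV. compositions I q)"
    using *(1) by (simp add: case_prod_unfold norm_mult prod_norm[symmetric] norm_divide norm_power)
  then show "((\<lambda>a. h (\<Sum>v\<in>I. a v) * (\<Prod>v\<in>I. t v ^ a v / fact (a v))) has_sum S) (I \<rightarrow>\<^sub>E UNIV)"
    by (rule has_sum_multinomial_expansion_aux[OF assms(1,2) abs_summable_summable])
  show "((\<lambda>a. norm (h (\<Sum>v\<in>I. a v) * (\<Prod>v\<in>I. t v ^ a v / fact (a v)))) has_sum S') (I \<rightarrow>\<^sub>E UNIV)"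
    using *(2) by (simp add: norm_mult prod_norm[symmetric] norm_divide norm_power)
qed

section \<open>Products of families of series\<close>

text \<open>
  Distributivity for absolutely convergent series. Value and norm are treated in one induction, since
  each step multiplies two series and therefore needs the absolute convergence of the partial product.
\<close>

lemma has_sum_product_PiE_aux:
  fixes f :: "'i \<Rightarrow> 'b \<Rightarrow> 'a :: {real_normed_field, banach}"
  assumes "finite I" and "\<And>i. i \<in> I \<Longrightarrow> (f i has_sum s i) (B i)"
    and "\<And>i. i \<in> I \<Longrightarrow> ((\<lambda>x. norm (f i x)) has_sum s' i) (B i)"
  shows "((\<lambda>g. \<Prod>i\<in>I. f i (g i)) has_sum (\<Prod>i\<in>I. s i)) (PiE I B) \<and>
         ((\<lambda>g. norm (\<Prod>i\<in>I. f i (g i))) has_sum (\<Prod>i\<in>I. s' i)) (PiE I B)"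
  using assms
proof (induction I)
  case empty
  show ?case by (auto intro: has_sum_finiteI)
next
  case (insert x I)
  have IH: "((\<lambda>g. \<Prod>i\<in>I. f i (g i)) has_sum (\<Prod>i\<in>I. s i)) (PiE I B)"
    "((\<lambda>g. norm (\<Prod>i\<in>I. f i (g i))) has_sum (\<Prod>i\<in>I. s' i)) (PiE I B)"
    using insert.IH insert.prems by blast+
  let ?F = "\<lambda>(n, a). f x n * (\<Prod>i\<in>I. f i (a i))"
  have s': "((\<lambda>y. norm (?F (n, y))) has_sum (norm (f x n) * (\<Prod>i\<in>I. s' i))) (PiE I B)" for n
    using has_sum_cmult_right[OF IH(2), of "norm (f x n)"] by (simp add: norm_mult)
  have s'2: "((\<lambda>n. norm (f x n) * (\<Prod>i\<in>I. s' i)) has_sum (s' x * (\<Prod>i\<in>I. s' i))) (B x)"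
    using insert.prems by (intro has_sum_cmult_left) auto
  have abs: "(\<lambda>y. norm (?F y)) summable_on (B x \<times> PiE I B)"
    by (intro summable_on_SigmaI[OF s' has_sum_imp_summable[OF s'2]]) auto
  have norm: "((\<lambda>y. norm (?F y)) has_sum (s' x * (\<Prod>i\<in>I. s' i))) (B x \<times> PiE I B)"
    by (intro has_sum_SigmaI[OF s' s'2] abs)
  have val: "(?F has_sum (s x * (\<Prod>i\<in>I. s i))) (B x \<times> PiE I B)"
  proof (rule has_sum_SigmaI)
    show "((\<lambda>y. ?F (n, y)) has_sum (f x n * (\<Prod>i\<in>I. s i))) (PiE I B)" for n
      using has_sum_cmult_right[OF IH(1), of "f x n"] by simp
    show "((\<lambda>n. f x n * (\<Prod>i\<in>I. s i)) has_sum (s x * (\<Prod>i\<in>I. s i))) (B x)"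
      using insert.prems by (intro has_sum_cmult_left) auto
    show "?F summable_on (B x \<times> PiE I B)"
      by (rule abs_summable_summable[OF abs])
  qed
  have upd: "(\<Prod>i\<in>insert x I. f i ((a(x := n)) i)) = ?F (n, a)" for n a
    using insert.hyps by (simp add: prod_fun_upd_notin[where g = f] del: fun_upd_apply) simp
  show ?case
    unfolding has_sum_reindex_bij_betw[OF bij_betw_PiE_insert[OF insert.hyps(2)], symmetric]
    unfolding case_prod_unfold upd
    using val norm insert.hyps by (simp add: case_prod_unfold)
qed

lemmas has_sum_product_PiE = has_sum_product_PiE_aux[THEN conjunct1]
  and has_sum_norm_product_PiE = has_sum_product_PiE_aux[THEN conjunct2]

section \<open>Uniqueness of the coefficients\<close>

text \<open>
  The zeros of a nonzero power series do not accumulate at the centre.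
\<close>

lemma power_series_zero_on_positive_reals:
  fixes a :: "nat \<Rightarrow> complex"
  assumes "e > 0" and sum: "\<And>s. 0 < s \<Longrightarrow> s < e \<Longrightarrow> ((\<lambda>n. a n * of_real s ^ n) has_sum 0) UNIV"
  shows "a m = 0"
proof (rule ccontr)
  assume "a m \<noteq> 0"
  \<comment> \<open>The isolation of zeros is applied to \<open>z\<close> times the series, which is certain to vanish at \<open>0\<close>.\<close>
  define b where "b n = (case n of 0 \<Rightarrow> 0 | Suc i \<Rightarrow> a i)" for n
  define f where "f z = z * (\<Sum>n. a n * z ^ n)" for z
  have summable: "summable (\<lambda>n. a n * z ^ n)" if "norm z < e / 2" for z
  proof (rule powser_inside)
    have "((\<lambda>n. a n * of_real (e / 2) ^ n) has_sum 0) UNIV"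
      by (rule sum) (use assms(1) in auto)
    then show "summable (\<lambda>n. a n * of_real (e / 2) ^ n)"
      using has_sum_imp_sums sums_summable by blast
    show "norm z < norm (of_real (e / 2) :: complex)"
      using that assms(1) unfolding norm_of_real by simp
  qed
  have "(\<lambda>n. b n * z ^ n) sums f z" if "norm z < e / 2" for z
  proof -
    have "(\<lambda>n. z * (a n * z ^ n)) sums f z"
      unfolding f_def by (intro sums_mult summable_sums summable that)
    then have "(\<lambda>n. b (Suc n) * z ^ Suc n) sums f z"
      by (simp add: b_def mult_ac)
    then show ?thesis
      using sums_Suc[of "\<lambda>n. b n * z ^ n" "f z"] by (simp add: b_def)
  qed
  then obtain s where s: "0 < s" "\<And>z. z \<in> cball 0 s - {0} \<Longrightarrow> f z \<noteq> 0"
    using powser_0_nonzero[of "e / 2" 0 b f "Suc m"] assms(1) \<open>a m \<noteq> 0\<close>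
    by (auto simp: b_def f_def)
  define x where "x = min s (e / 4)"
  have x: "0 < x" "x \<le> s" "x < e"
    using assms(1) s(1) by (auto simp: x_def)
  have "(\<Sum>n. a n * of_real x ^ n) = 0"
    using has_sum_imp_sums[OF sum[OF x(1,3)]] by (simp add: sums_iff)
  then have "f (of_real x) = 0"
    by (simp add: f_def)
  moreover have "of_real x \<in> cball 0 s - {0 :: complex}"
    using x by auto
  ultimately show False
    using s(2) by blast
qed

text \<open>
  For fixed values of all variables but one, the series is a power series in that variable which
  vanishes on an interval; hence each of its coefficients, a series in fewer variables, vanishes too.
\<close>

lemma multi_power_series_zero_on_positive_reals:
  fixes D :: "('i \<Rightarrow> nat) \<Rightarrow> complex"
  assumes "finite I" and "e > 0"
    and "\<And>t. (\<And>i. i \<in> I \<Longrightarrow> 0 < t i \<and> t i < e) \<Longrightarrow>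
           ((\<lambda>m. D m * (\<Prod>i\<in>I. of_real (t i) ^ m i)) has_sum 0) (I \<rightarrow>\<^sub>E UNIV)"
    and "m \<in> I \<rightarrow>\<^sub>E UNIV"
  shows "D m = 0"
  using assms(1,3,4)
proof (induction I arbitrary: D m)
  case empty
  have "((\<lambda>m. D m * (\<Prod>i\<in>{}. of_real 0 ^ m i)) has_sum 0) ({} \<rightarrow>\<^sub>E (UNIV :: nat set))"
    using empty.prems(1)[of "\<lambda>_. 0"] by simp
  moreover have "((\<lambda>m. D m * (\<Prod>i\<in>{}. of_real 0 ^ m i)) has_sum D m) ({} \<rightarrow>\<^sub>E (UNIV :: nat set))"
    using empty.prems(2) by (intro has_sum_finiteI) auto
  ultimately show ?case
    using has_sum_unique by blast
next
  case (insert x I)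
  have upd: "(\<Prod>i\<in>insert x I. of_real (t i) ^ (a(x := n)) i) =
      of_real (t x) ^ n * (\<Prod>i\<in>I. of_real (t i) ^ a i :: complex)" for t :: "'i \<Rightarrow> real" and a n
    using insert.hyps
    by (simp add: prod_fun_upd_notin[where g = "\<lambda>i n. of_real (t i) ^ n"] del: fun_upd_apply) simp
  have total: "((\<lambda>(n, a). D (a(x := n)) * (of_real (t x) ^ n * (\<Prod>i\<in>I. of_real (t i) ^ a i))) has_sum 0)
      (UNIV \<times> (I \<rightarrow>\<^sub>E UNIV))" if "\<And>i. i \<in> insert x I \<Longrightarrow> 0 < t i \<and> t i < e" for t
    using insert.prems(1)[OF that]
    unfolding has_sum_reindex_bij_betw[OF bij_betw_PiE_insert[OF insert.hyps(2)], symmetric]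
      case_prod_unfold upd by simp
  have slice: "((\<lambda>a. D (a(x := n)) * (\<Prod>i\<in>I. of_real (t i) ^ a i)) has_sum 0) (I \<rightarrow>\<^sub>E UNIV)"
    if t: "\<And>i. i \<in> I \<Longrightarrow> 0 < t i \<and> t i < e" for t n
  proof -
    define c where "c n = (\<Sum>\<^sub>\<infinity>a\<in>I \<rightarrow>\<^sub>E UNIV. D (a(x := n)) * (\<Prod>i\<in>I. of_real (t i) ^ a i))" for n
    have tx: "(\<Prod>i\<in>I. of_real ((t(x := s)) i) ^ a i) = (\<Prod>i\<in>I. of_real (t i) ^ a i :: complex)" for s a
      using insert.hyps by (intro prod.cong) auto
    have total': "((\<lambda>(n, a). D (a(x := n)) * (of_real s ^ n * (\<Prod>i\<in>I. of_real (t i) ^ a i))) has_sum 0)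
        (UNIV \<times> (I \<rightarrow>\<^sub>E UNIV))" if "0 < s" "s < e" for s
    proof -
      have "0 < (t(x := s)) i \<and> (t(x := s)) i < e" if "i \<in> insert x I" for i
        using t \<open>0 < s\<close> \<open>s < e\<close> that by auto
      from total[of "t(x := s)", OF this] show ?thesis
        unfolding tx fun_upd_same .
    qed
    have c: "((\<lambda>a. D (a(x := n)) * (\<Prod>i\<in>I. of_real (t i) ^ a i)) has_sum c n) (I \<rightarrow>\<^sub>E UNIV)" for n
    proof -
      have "(\<lambda>a. D (a(x := n)) * (of_real (e / 2) ^ n * (\<Prod>i\<in>I. of_real (t i) ^ a i))) summable_on
          (I \<rightarrow>\<^sub>E UNIV)"
        using summable_on_SigmaD1[OF has_sum_imp_summable[OF total'[of "e / 2"]], of n] assms(2)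
        by simp
      then have "(\<lambda>a. (1 / of_real (e / 2)) ^ n *
          (D (a(x := n)) * (of_real (e / 2) ^ n * (\<Prod>i\<in>I. of_real (t i) ^ a i)))) summable_on (I \<rightarrow>\<^sub>E UNIV)"
        by (rule summable_on_cmult_right)
      also have "(\<lambda>a. (1 / of_real (e / 2)) ^ n *
          (D (a(x := n)) * (of_real (e / 2) ^ n * (\<Prod>i\<in>I. of_real (t i) ^ a i)))) =
          (\<lambda>a. D (a(x := n)) * (\<Prod>i\<in>I. of_real (t i) ^ a i))"
        using assms(2) by (simp add: power_divide)
      finally show ?thesis
        unfolding c_def by (rule has_sum_infsum)
    qed
    have "((\<lambda>n. c n * of_real s ^ n) has_sum 0) UNIV" if "0 < s" "s < e" for s
    proof (rule has_sum_SigmaD[OF total'[OF that]])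
      show "((\<lambda>a. case (n, a) of (n, a) \<Rightarrow>
          D (a(x := n)) * (of_real s ^ n * (\<Prod>i\<in>I. of_real (t i) ^ a i))) has_sum c n * of_real s ^ n)
          (I \<rightarrow>\<^sub>E UNIV)" for n
        using has_sum_cmult_left[OF c, of n "of_real s ^ n"] by (simp add: mult_ac)
    qed
    then have "c n = 0" for n
      using power_series_zero_on_positive_reals[OF assms(2)] by blast
    then show ?thesis
      using c[of n] by simp
  qed
  have "D ((m(x := undefined))(x := m x)) = 0"
  proof (rule insert.IH[of "\<lambda>a. D (a(x := m x))"])
    show "m(x := undefined) \<in> I \<rightarrow>\<^sub>E UNIV"
      using insert.prems(2) by (auto simp: PiE_def extensional_def)
  qed (rule slice)
  then show ?case by simp
qed

text \<open>
  The quotient defining the numbers is expanded only off the zeros of the denominator. Positive real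
  arguments avoid these zeros, and they suffice to determine the coefficients.
\<close>

lemma one_minus_exp_of_positive_real_nonzero:
  assumes "\<And>i. i \<in> {1..r} \<Longrightarrow> 0 < (t i :: real)" and "j \<in> {1..r}"
  shows "one_minus_exp r (\<lambda>i. of_real (t i)) j \<noteq> 0"
proof -
  have "(\<Sum>v=j..r. t v) > 0"
    using assms by (intro sum_pos) auto
  then have "exp (- (\<Sum>v=j..r. t v)) \<noteq> 1"
    by simp
  moreover have "one_minus_exp r (\<lambda>i. of_real (t i)) j = of_real (1 - exp (- (\<Sum>v=j..r. t v)))"
    by (simp add: one_minus_exp_def exp_of_real[symmetric])
  ultimately show ?thesis
    by (metis eq_iff_diff_eq_0 of_real_eq_0_iff)
qed

lemma poly_bernoulli_expansion_unique:
  assumes "poly_bernoulli_expansion r k B" and "poly_bernoulli_expansion r k B'"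
    and m: "m \<in> multi_indices r"
  shows "B m = B' m"
proof -
  obtain e where e: "e > 0" "\<And>t. (\<forall>j\<in>{1..r}. norm (t j) < e \<and> one_minus_exp r t j \<noteq> 0) \<Longrightarrow>
        ((\<lambda>m. B m * (\<Prod>j=1..r. t j ^ m j / fact (m j))) has_sum
           (Li_sh r k (one_minus_exp r t) / (\<Prod>j=1..r. one_minus_exp r t j))) (multi_indices r)"
    using assms(1) unfolding poly_bernoulli_expansion_def by blast
  obtain e' where e': "e' > 0" "\<And>t. (\<forall>j\<in>{1..r}. norm (t j) < e' \<and> one_minus_exp r t j \<noteq> 0) \<Longrightarrow>
        ((\<lambda>m. B' m * (\<Prod>j=1..r. t j ^ m j / fact (m j))) has_sum
           (Li_sh r k (one_minus_exp r t) / (\<Prod>j=1..r. one_minus_exp r t j))) (multi_indices r)"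
    using assms(2) unfolding poly_bernoulli_expansion_def by blast
  have "(B m - B' m) / (\<Prod>j=1..r. fact (m j)) = 0"
  proof (rule multi_power_series_zero_on_positive_reals
      [of "{1..r}" "min e e'" "\<lambda>m. (B m - B' m) / (\<Prod>j=1..r. fact (m j))"])
    fix t :: "nat \<Rightarrow> real"
    assume t: "\<And>i. i \<in> {1..r} \<Longrightarrow> 0 < t i \<and> t i < min e e'"
    then have nz: "one_minus_exp r (\<lambda>i. of_real (t i)) j \<noteq> 0" if "j \<in> {1..r}" for j
      using that by (intro one_minus_exp_of_positive_real_nonzero) auto
    show "((\<lambda>m. (B m - B' m) / (\<Prod>j=1..r. fact (m j)) * (\<Prod>i\<in>{1..r}. of_real (t i) ^ m i)) has_sum 0)
        ({1..r} \<rightarrow>\<^sub>E UNIV)"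
    proof -
      let ?t = "\<lambda>i. of_real (t i) :: complex"
      have small: "\<forall>j\<in>{1..r}. norm (?t j) < e \<and> one_minus_exp r ?t j \<noteq> 0"
        "\<forall>j\<in>{1..r}. norm (?t j) < e' \<and> one_minus_exp r ?t j \<noteq> 0"
        using t nz by fastforce+
      have "(B m - B' m) / (\<Prod>j=1..r. fact (m j)) * (\<Prod>i\<in>{1..r}. ?t i ^ m i) =
          B m * (\<Prod>j=1..r. ?t j ^ m j / fact (m j)) - B' m * (\<Prod>j=1..r. ?t j ^ m j / fact (m j))" for m
        unfolding prod_dividef by (simp add: field_simps)
      then show ?thesis
        using has_sum_add[OF e(2)[OF small(1)] has_sum_uminusI[OF e'(2)[OF small(2)]]]
        by (simp only: multi_indices_def diff_conv_add_uminus add.right_inverse)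
    qed
  qed (use e e' m in \<open>auto simp: multi_indices_def\<close>)
  then show ?thesis by simp
qed

section \<open>The polylogarithm as a sum over gaps\<close>

text \<open>
  An increasing tuple is encoded by its gaps, each diminished by one; \<open>partial_sums\<close> recovers the tuple.
  Accordingly, \<open>gap_weight\<close> is the denominator of the term of the polylogarithm that belongs to the
  gaps \<open>l\<close>.
\<close>

definition gap_weight :: "nat \<Rightarrow> (nat \<Rightarrow> int) \<Rightarrow> (nat \<Rightarrow> nat) \<Rightarrow> complex" where
  "gap_weight r k l = (\<Prod>j=1..r. of_nat ((\<Sum>i=1..j. l i) + j) powi k j)"

definition partial_sums :: "nat \<Rightarrow> (nat \<Rightarrow> nat) \<Rightarrow> nat \<Rightarrow> nat" where
  "partial_sums r l = (\<lambda>j\<in>{1..r}. (\<Sum>i=1..j. l i) + j)"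

lemma sum_split_last:
  fixes f :: "nat \<Rightarrow> nat"
  assumes "1 < (j :: nat)"
  shows "(\<Sum>i=1..j. f i) = (\<Sum>i=1..j - 1. f i) + f j"
  using assms by (cases j) auto

lemma bij_betw_partial_sums:
  "bij_betw (partial_sums r) (multi_indices r) (increasing_tuples r)"
proof (rule bij_betwI[where g =
      "\<lambda>p. \<lambda>j\<in>{1..r}. if j = 1 then p 1 - 1 else p j - p (j - 1) - 1"])
  show "partial_sums r \<in> multi_indices r \<rightarrow> increasing_tuples r"
  proof
    fix l
    have "strict_mono_on {1..r} (partial_sums r l)"
    proof (rule strict_mono_onI)
      fix i j :: nat
      assume "i \<in> {1..r}" "j \<in> {1..r}" "i < j"
      moreover from \<open>i < j\<close> have "(\<Sum>i=1..i. l i) \<le> (\<Sum>i=1..j. l i)"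
        by (intro sum_mono2) auto
      ultimately show "partial_sums r l i < partial_sums r l j"
        by (simp add: partial_sums_def)
    qed
    then show "partial_sums r l \<in> increasing_tuples r"
      by (auto simp: increasing_tuples_def partial_sums_def)
  qed
  show "(\<lambda>p. \<lambda>j\<in>{1..r}. if j = 1 then p 1 - 1 else p j - p (j - 1) - 1) \<in>
      increasing_tuples r \<rightarrow> multi_indices r"
    by (auto simp: multi_indices_def)
  show "(\<lambda>j\<in>{1..r}. if j = 1 then partial_sums r l 1 - 1
      else partial_sums r l j - partial_sums r l (j - 1) - 1) = l" if "l \<in> multi_indices r" for l
  proof (rule PiE_ext[OF _ that[unfolded multi_indices_def]])
    fix j assume j: "j \<in> {1..r}"
    show "(\<lambda>j\<in>{1..r}. if j = 1 then partial_sums r l 1 - 1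
        else partial_sums r l j - partial_sums r l (j - 1) - 1) j = l j"
    proof (cases "j = 1")
      case True
      then show ?thesis using j by (simp add: partial_sums_def)
    next
      case False
      then have "1 < j" "j - 1 \<in> {1..r}" using j by auto
      then show ?thesis using j False sum_split_last[of j l] by (simp add: partial_sums_def)
    qed
  qed auto
  show "partial_sums r (\<lambda>j\<in>{1..r}. if j = 1 then p 1 - 1 else p j - p (j - 1) - 1) = p"
    (is "partial_sums r ?l = p") if p: "p \<in> increasing_tuples r" for p
  proof (rule PiE_ext[where k = "{1..r}" and s = "\<lambda>_. UNIV"])
    have pos: "p j > 0" if "j \<in> {1..r}" for j
      using p that by (auto simp: increasing_tuples_def)
    have less: "p j < p (Suc j)" if "1 \<le> j" "Suc j \<le> r" for j
      using p that by (auto simp: increasing_tuples_def strict_mono_on_def)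
    fix j assume "j \<in> {1..r}"
    then have "1 \<le> j" "j \<le> r" by auto
    then have "(\<Sum>i=1..j. ?l i) + j = p j"
    proof (induction j rule: nat_induct_at_least)
      case base
      then show ?case using pos[of 1] by simp
    next
      case (Suc j)
      then have "(\<Sum>i=1..Suc j. ?l i) = (\<Sum>i=1..j. ?l i) + (p (Suc j) - p j - 1)"
        by simp
      moreover have "p j < p (Suc j)"
        using less Suc by simp
      ultimately show ?case
        using Suc by simp
    qed
    then show "partial_sums r ?l j = p j"
      using \<open>j \<in> {1..r}\<close> by (simp add: partial_sums_def)
  qed (use p in \<open>auto simp: partial_sums_def increasing_tuples_def\<close>)
qed

text \<open>
  In terms of the gaps, the exponent of \<open>z j\<close> is \<open>l j + 1\<close>, so that the product of all
  \<open>z j\<close> splits off: this is the denominator of the generating function.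
\<close>

lemma Li_sh_eq_gap_sum:
  assumes "((\<lambda>l. (\<Prod>j=1..r. z j ^ l j) / gap_weight r k l) has_sum S) (multi_indices r)"
  shows "Li_sh r k z = (\<Prod>j=1..r. z j) * S"
proof -
  let ?f = "\<lambda>p. (\<Prod>j=1..r. z j ^ (if j = 1 then p 1 else p j - p (j - 1)))
          / (\<Prod>j=1..r. of_nat (p j) powi k j)"
  have "?f (partial_sums r l) = (\<Prod>j=1..r. z j) * ((\<Prod>j=1..r. z j ^ l j) / gap_weight r k l)" for l
  proof -
    have "(if j = 1 then partial_sums r l 1 else partial_sums r l j - partial_sums r l (j - 1)) =
        Suc (l j)" if "j \<in> {1..r}" for j
    proof (cases "j = 1")
      case False
      then have "1 < j" "j - 1 \<in> {1..r}" using that by auto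
      then show ?thesis using that sum_split_last[of j l] by (simp add: partial_sums_def)
    qed (use that in \<open>simp add: partial_sums_def\<close>)
    then have "(\<Prod>j=1..r. z j ^ (if j = 1 then partial_sums r l 1
          else partial_sums r l j - partial_sums r l (j - 1))) = (\<Prod>j=1..r. z j * z j ^ l j)"
      by (intro prod.cong) auto
    moreover have "(\<Prod>j=1..r. of_nat (partial_sums r l j) powi k j) = gap_weight r k l"
      unfolding gap_weight_def by (intro prod.cong) (auto simp: partial_sums_def)
    ultimately show ?thesis
      by (simp only: prod.distrib times_divide_eq_right)
  qed
  moreover have "((\<lambda>l. (\<Prod>j=1..r. z j) * ((\<Prod>j=1..r. z j ^ l j) / gap_weight r k l)) has_sum
      (\<Prod>j=1..r. z j) * S) (multi_indices r)"
    by (intro has_sum_cmult_right assms)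
  ultimately have "((\<lambda>l. ?f (partial_sums r l)) has_sum (\<Prod>j=1..r. z j) * S) (multi_indices r)"
    by (simp only:)
  then have "(?f has_sum (\<Prod>j=1..r. z j) * S) (increasing_tuples r)"
    using has_sum_reindex_bij_betw[OF bij_betw_partial_sums, of ?f] by (simp only:)
  then show ?thesis
    unfolding Li_sh_def by (rule infsumI)
qed

section \<open>Absolute convergence near the origin\<close>

lemma power_le_fact_mult_exp:
  fixes x :: real
  assumes "x \<ge> 0"
  shows "x ^ n \<le> fact n * exp x"
proof -
  have "(\<Sum>i\<in>{n}. inverse (fact i) * x ^ i) \<le> (\<Sum>i. inverse (fact i) * x ^ i)"
    using assms by (intro sum_le_suminf summable_exp) auto
  also have "(\<Sum>i. inverse (fact i) * x ^ i) = exp x"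
    by (simp add: exp_def scaleR_conv_of_real)
  finally show ?thesis
    by (simp add: field_simps)
qed

text \<open>
  For negative \<open>k j\<close> the terms carry polynomially growing factors. A bound that is a product over
  the gaps is required, and polynomial growth is therefore absorbed into an exponential.
\<close>

lemma norm_inverse_gap_weight_le:
  obtains C :: real where "C \<ge> 0"
    and "\<And>l. norm (1 / gap_weight r k l) \<le> C * (\<Prod>j=1..r. exp 1 ^ l j)"
proof
  define K where "K = (\<Sum>j=1..r. nat \<bar>k j\<bar>)"
  show "fact K * exp (real r) \<ge> 0" by simp
  fix l :: "nat \<Rightarrow> nat"
  \<comment> \<open>\<open>P\<close> is the largest partial sum; it dominates all the others.\<close>
  define P where "P = (\<Sum>i=1..r. l i) + r"
  have "norm (1 / gap_weight r k l) = (\<Prod>j=1..r. inverse (real ((\<Sum>i=1..j. l i) + j) powi k j))"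
    unfolding gap_weight_def
    by (simp add: norm_divide norm_power_int prod_norm[symmetric] prod_dividef inverse_eq_divide
        del: of_nat_add of_nat_sum)
  also have "\<dots> \<le> (\<Prod>j=1..r. real P ^ nat \<bar>k j\<bar>)"
  proof (intro prod_mono conjI)
    fix j assume j: "j \<in> {1..r}"
    define p where "p = (\<Sum>i=1..j. l i) + j"
    have "(\<Sum>i=1..j. l i) \<le> (\<Sum>i=1..r. l i)"
      using j by (intro sum_mono2) auto
    then have p: "1 \<le> p" "p \<le> P"
      using j by (auto simp: p_def P_def)
    have "inverse (real p powi k j) \<le> real p ^ nat \<bar>k j\<bar>"
    proof (cases "k j \<ge> 0")
      case True
      have "1 \<le> real p ^ nat (k j)"
        using p by simp
      then have "inverse (real p ^ nat (k j)) \<le> real p ^ nat (k j)"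
        by (meson dual_order.trans inverse_le_1_iff)
      with True show ?thesis by (simp add: power_int_def)
    next
      case False
      then show ?thesis by (simp add: power_int_def power_inverse)
    qed
    also have "\<dots> \<le> real P ^ nat \<bar>k j\<bar>"
      using p by (intro power_mono) auto
    finally show "inverse (real ((\<Sum>i=1..j. l i) + j) powi k j) \<le> real P ^ nat \<bar>k j\<bar>"
      by (simp only: p_def)
  qed (auto simp del: of_nat_add of_nat_sum)
  also have "\<dots> = real P ^ K"
    by (simp add: K_def power_sum)
  also have "\<dots> \<le> fact K * exp (real P)"
    by (rule power_le_fact_mult_exp) simp
  also have "exp (real P) = exp (real r) * (\<Prod>j=1..r. exp 1 ^ l j)"
    by (simp add: P_def exp_add exp_sum exp_of_nat_mult[symmetric])
  finally show "norm (1 / gap_weight r k l) \<le> fact K * exp (real r) * (\<Prod>j=1..r. exp 1 ^ l j)"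
    by (simp add: mult.assoc)
qed

text \<open>
  The arrays record the exponents in the expansion of the powers of the sums \<open>t j + \<dots> + t r\<close>:
  \<open>a j v\<close> is the exponent of \<open>t v\<close> taken from the \<open>j\<close>-th sum, whence \<open>j \<le> v\<close>.
\<close>

definition triangular_arrays :: "nat \<Rightarrow> (nat \<Rightarrow> nat \<Rightarrow> nat) set" where
  "triangular_arrays r = (\<Pi>\<^sub>E j\<in>{1..r}. {j..r} \<rightarrow>\<^sub>E UNIV)"

definition expansion_term ::
    "nat \<Rightarrow> (nat \<Rightarrow> complex) \<Rightarrow> (nat \<Rightarrow> nat) \<Rightarrow> (nat \<Rightarrow> nat \<Rightarrow> nat) \<Rightarrow> complex" where
  "expansion_term r t l a = (\<Prod>j=1..r. one_minus_exp_coeff (l j) (\<Sum>v=j..r. a j v) *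
     (\<Prod>v=j..r. t v ^ a j v / fact (a j v)))"

text \<open>
  Row \<open>j\<close> of the array expands one factor, by the Stirling series composed with the multinomial
  theorem; multiplying the rows together expands the product.
\<close>

lemma expansion_term_has_sum:
  "(expansion_term r t l has_sum (\<Prod>j=1..r. one_minus_exp r t j ^ l j)) (triangular_arrays r)"
  "((\<lambda>a. norm (expansion_term r t l a)) has_sum
     (\<Prod>j=1..r. (exp (\<Sum>v=j..r. norm (t v)) - 1) ^ l j)) (triangular_arrays r)"
proof -
  note row = has_sum_multinomial_expansion[OF finite_atLeastAtMost one_minus_exp_power_has_sum
      one_minus_exp_power_norm_has_sum]
  have nonneg: "0 \<le> (\<Sum>v=j..r. norm (t v))" for j
    by (simp add: sum_nonneg)
  show "(expansion_term r t l has_sum (\<Prod>j=1..r. one_minus_exp r t j ^ l j)) (triangular_arrays r)"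
    unfolding expansion_term_def triangular_arrays_def one_minus_exp_def
    by (rule has_sum_product_PiE[OF finite_atLeastAtMost row(1) row(2)]) (rule nonneg)+
  show "((\<lambda>a. norm (expansion_term r t l a)) has_sum
     (\<Prod>j=1..r. (exp (\<Sum>v=j..r. norm (t v)) - 1) ^ l j)) (triangular_arrays r)"
    unfolding expansion_term_def triangular_arrays_def
    by (rule has_sum_norm_product_PiE[OF finite_atLeastAtMost row(1) row(2)]) (rule nonneg)+
qed

lemma geometric_product_summable:
  fixes x :: "'i \<Rightarrow> real"
  assumes "finite I" and "\<And>i. i \<in> I \<Longrightarrow> 0 \<le> x i \<and> x i < 1"
  shows "(\<lambda>l. \<Prod>i\<in>I. x i ^ l i) summable_on (I \<rightarrow>\<^sub>E UNIV)"
proof -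
  have "((\<lambda>n. x i ^ n) has_sum (\<Sum>n. x i ^ n)) UNIV" "((\<lambda>n. norm (x i ^ n)) has_sum (\<Sum>n. x i ^ n)) UNIV"
    if "i \<in> I" for i
  proof -
    have "summable (\<lambda>n. norm (x i ^ n))" "summable (\<lambda>n. x i ^ n)"
      using assms(2)[OF that] by (auto simp: norm_power intro: summable_geometric)
    then show *: "((\<lambda>n. x i ^ n) has_sum (\<Sum>n. x i ^ n)) UNIV"
      by (intro norm_summable_imp_has_sum summable_sums)
    then show "((\<lambda>n. norm (x i ^ n)) has_sum (\<Sum>n. x i ^ n)) UNIV"
      using assms(2)[OF that] by (simp add: norm_power)
  qed
  then show ?thesis
    by (intro has_sum_imp_summable[OF has_sum_product_PiE[OF assms(1)]])
qed

text \<open>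
  The value is chosen so that all the sums \<open>W\<close> of norms involved stay below \<open>ln (1 + exp (-1))\<close>,
  that is, \<open>exp 1 * (exp W - 1) < 1\<close>. The factor \<open>exp 1\<close> pays for the growth of the
  reciprocal gap weights.
\<close>

definition expansion_radius :: "nat \<Rightarrow> real" where
  "expansion_radius r = ln (1 + exp (-1)) / real r"

lemma expansion_radius_pos: "r \<ge> 1 \<Longrightarrow> expansion_radius r > 0"
  unfolding expansion_radius_def by (intro divide_pos_pos ln_gt_zero) auto

lemma exp_tail_sum_less:
  fixes t :: "nat \<Rightarrow> 'a :: real_normed_vector"
  assumes "\<And>v. v \<in> {1..r} \<Longrightarrow> norm (t v) < expansion_radius r" and "j \<in> {1..r}"
  shows "exp 1 * (exp (\<Sum>v=j..r. norm (t v)) - 1) < 1"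
proof -
  have "(\<Sum>v=j..r. norm (t v)) \<le> (\<Sum>v=1..r. norm (t v))"
    using assms(2) by (intro sum_mono2) auto
  also have "\<dots> < (\<Sum>v=1..r. expansion_radius r)"
    using assms by (intro sum_strict_mono) auto
  also have "\<dots> = ln (1 + exp (-1))"
    using assms(2) by (simp add: expansion_radius_def)
  finally have "exp (\<Sum>v=j..r. norm (t v)) < exp (ln (1 + exp (-1)))"
    by simp
  also have "\<dots> = 1 + exp (-1)"
    by (simp add: add_pos_pos)
  finally have "exp 1 * (exp (\<Sum>v=j..r. norm (t v)) - 1) < exp 1 * exp (-1)"
    by simp
  then show ?thesis
    by (simp add: exp_minus)
qed

text \<open>
  Expanding every power of \<open>one_minus_exp r t j\<close> yields one absolutely convergent sum over gaps and arrays,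
  which may then be rearranged freely.
\<close>

lemma Li_sh_quotient_has_sum:
  assumes "\<And>v. v \<in> {1..r} \<Longrightarrow> norm (t v) < expansion_radius r"
    and nz: "\<And>j. j \<in> {1..r} \<Longrightarrow> one_minus_exp r t j \<noteq> 0"
  shows "((\<lambda>(l, a). expansion_term r t l a / gap_weight r k l) has_sum
           (Li_sh r k (one_minus_exp r t) / (\<Prod>j=1..r. one_minus_exp r t j)))
           (multi_indices r \<times> triangular_arrays r)"
proof -
  let ?F = "\<lambda>(l, a). expansion_term r t l a / gap_weight r k l"
  define W where "W j = (exp (\<Sum>v=j..r. norm (t v)) - 1)" for j
  have W: "0 \<le> W j" for j
    by (simp add: W_def sum_nonneg)
  obtain C where C: "C \<ge> 0" "\<And>l. norm (1 / gap_weight r k l) \<le> C * (\<Prod>j=1..r. exp 1 ^ l j)"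
    using norm_inverse_gap_weight_le[of r k] by blast
  have "(\<lambda>l. \<Prod>j\<in>{1..r}. (exp 1 * W j) ^ l j) summable_on ({1..r} \<rightarrow>\<^sub>E UNIV)"
    using exp_tail_sum_less[OF assms(1)] W by (intro geometric_product_summable) (auto simp: W_def)
  then have "(\<lambda>l. C * (\<Prod>j\<in>{1..r}. (exp 1 * W j) ^ l j)) summable_on multi_indices r"
    unfolding multi_indices_def by (rule summable_on_cmult_right)
  then have outer: "(\<lambda>l. norm (1 / gap_weight r k l) * (\<Prod>j=1..r. W j ^ l j)) summable_on multi_indices r"
  proof (rule summable_on_comparison_test)
    fix l
    have "norm (1 / gap_weight r k l) * (\<Prod>j=1..r. W j ^ l j) \<le>
        C * (\<Prod>j=1..r. exp 1 ^ l j) * (\<Prod>j=1..r. W j ^ l j)"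
      using W by (intro mult_right_mono C prod_nonneg) auto
    then show "norm (1 / gap_weight r k l) * (\<Prod>j=1..r. W j ^ l j) \<le>
        C * (\<Prod>j\<in>{1..r}. (exp 1 * W j) ^ l j)"
      by (simp only: power_mult_distrib prod.distrib mult.assoc)
  qed (use W in \<open>auto intro!: mult_nonneg_nonneg prod_nonneg\<close>)
  have "(\<lambda>x. norm (?F x)) summable_on (multi_indices r \<times> triangular_arrays r)"
  proof (rule summable_on_SigmaI[OF _ outer])
    fix l
    show "((\<lambda>a. norm (?F (l, a))) has_sum norm (1 / gap_weight r k l) * (\<Prod>j=1..r. W j ^ l j))
        (triangular_arrays r)"
      using has_sum_cmult_right[OF expansion_term_has_sum(2)[of r t l], of "norm (1 / gap_weight r k l)"]
      by (simp add: norm_divide W_def)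
  qed auto
  then have F: "(?F has_sum infsum ?F (multi_indices r \<times> triangular_arrays r))
      (multi_indices r \<times> triangular_arrays r)"
    by (rule has_sum_infsum[OF abs_summable_summable])
  have "((\<lambda>l. (\<Prod>j=1..r. one_minus_exp r t j ^ l j) / gap_weight r k l) has_sum
      infsum ?F (multi_indices r \<times> triangular_arrays r)) (multi_indices r)"
  proof (rule has_sum_SigmaD[OF F])
    show "((\<lambda>a. ?F (l, a)) has_sum (\<Prod>j=1..r. one_minus_exp r t j ^ l j) / gap_weight r k l)
        (triangular_arrays r)" for l
      using has_sum_cmult_left[OF expansion_term_has_sum(1)[of r t l], of "1 / gap_weight r k l"]
      by simp
  qed
  then have "Li_sh r k (one_minus_exp r t) =
      (\<Prod>j=1..r. one_minus_exp r t j) * infsum ?F (multi_indices r \<times> triangular_arrays r)"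
    by (rule Li_sh_eq_gap_sum)
  moreover have "(\<Prod>j=1..r. one_minus_exp r t j) \<noteq> 0"
    using nz by simp
  ultimately show ?thesis
    using F by simp
qed

section \<open>Arrays with given column sums\<close>

definition closed_formula :: "nat \<Rightarrow> (nat \<Rightarrow> int) \<Rightarrow> (nat \<Rightarrow> nat) \<Rightarrow> complex" where
  "closed_formula r k m =
    (-1) ^ (\<Sum>j=1..r. m j) *
    (\<Sum>l \<in> {1..r} \<rightarrow>\<^sub>E {0..(\<Sum>j=1..r. m j)}.
       ((-1) ^ (\<Sum>j=1..r. l j) * (\<Prod>j=1..r. fact (l j)))
         / (\<Prod>j=1..r. of_nat ((\<Sum>i=1..j. l i) + j) powi k j)
       * (\<Sum>n \<in> row_families r m.
            (\<Prod>i\<in>{1..<r}. multinomial (m (i + 1)) {1..i + 1} (\<lambda>j. n (i, j)))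
            * (\<Prod>j=1..r. of_nat (Stirling (stirling_top r m n j) (l j)))))"

text \<open>
  The arrays that contribute to the monomial with exponents \<open>m\<close>: column \<open>v\<close> collects all
  the factors \<open>t v\<close>.
\<close>

definition column_fibre :: "nat \<Rightarrow> (nat \<Rightarrow> nat) \<Rightarrow> (nat \<Rightarrow> nat \<Rightarrow> nat) set" where
  "column_fibre r m = {a \<in> triangular_arrays r. \<forall>v\<in>{1..r}. (\<Sum>j=1..v. a j v) = m v}"

text \<open>
  A family \<open>n\<close> lists the columns \<open>2, \<dots>, r\<close> of an array, row \<open>i\<close> of the family being
  column \<open>i + 1\<close>. The first column has a single entry, which its sum forces to be \<open>m 1\<close>.
\<close>

definition array_of_family :: "nat \<Rightarrow> (nat \<Rightarrow> nat) \<Rightarrow> (nat \<times> nat \<Rightarrow> nat) \<Rightarrow> nat \<Rightarrow> nat \<Rightarrow> nat" where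
  "array_of_family r m n = (\<lambda>j\<in>{1..r}. \<lambda>v\<in>{j..r}. if v = 1 then m 1 else n (v - 1, j))"

lemma row_family_sum:
  assumes "n \<in> row_families r m" and "2 \<le> v" "v \<le> r"
  shows "(\<Sum>j=1..v. n (v - 1, j)) = m v"
proof -
  have "v - 1 \<in> {1..<r}" "v - 1 + 1 = v"
    using assms(2,3) by auto
  then show ?thesis
    using assms(1) unfolding row_families_def by fastforce
qed

lemma bij_betw_array_of_family:
  "bij_betw (array_of_family r m) (row_families r m) (column_fibre r m)"
proof (rule bij_betwI[where g =
      "\<lambda>a. restrict (\<lambda>(i, j). a j (i + 1)) (SIGMA i:{1..<r}. {1..i + 1})"])
  show "array_of_family r m \<in> row_families r m \<rightarrow> column_fibre r m"
  proof
    fix n assume n: "n \<in> row_families r m"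
    have "(\<Sum>j=1..v. array_of_family r m n j v) = m v" if v: "v \<in> {1..r}" for v
    proof (cases "v = 1")
      case True
      then show ?thesis using v by (simp add: array_of_family_def)
    next
      case False
      then have "(\<Sum>j=1..v. array_of_family r m n j v) = (\<Sum>j=1..v. n (v - 1, j))"
        using v by (intro sum.cong) (auto simp: array_of_family_def)
      then show ?thesis
        using row_family_sum[OF n, of v] v False by simp
    qed
    then show "array_of_family r m n \<in> column_fibre r m"
      by (auto simp: column_fibre_def triangular_arrays_def array_of_family_def)
  qed
  show "(\<lambda>a. restrict (\<lambda>(i, j). a j (i + 1)) (SIGMA i:{1..<r}. {1..i + 1})) \<in>
      column_fibre r m \<rightarrow> row_families r m"
  proof
    fix a assume a: "a \<in> column_fibre r m"
    have "\<forall>i\<in>{1..<r}. (\<Sum>j=1..i + 1. restrict (\<lambda>(i, j). a j (i + 1)) (SIGMA i:{1..<r}. {1..i + 1}) (i, j)) =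
        m (i + 1)"
    proof
      fix i assume that: "i \<in> {1..<r}"
      have "(\<Sum>j=1..i + 1. restrict (\<lambda>(i, j). a j (i + 1)) (SIGMA i:{1..<r}. {1..i + 1}) (i, j)) =
          (\<Sum>j=1..i + 1. a j (i + 1))"
        using that by (intro sum.cong) auto
      also have "\<dots> = m (i + 1)"
        using a that unfolding column_fibre_def by (simp del: sum.cl_ivl_Suc)
      finally show "(\<Sum>j=1..i + 1. restrict (\<lambda>(i, j). a j (i + 1)) (SIGMA i:{1..<r}. {1..i + 1}) (i, j)) =
        m (i + 1)" .
    qed
    moreover have "restrict (\<lambda>(i, j). a j (i + 1)) (SIGMA i:{1..<r}. {1..i + 1}) \<in>
        (SIGMA i:{1..<r}. {1..i + 1}) \<rightarrow>\<^sub>E UNIV"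
      by auto
    ultimately show "restrict (\<lambda>(i, j). a j (i + 1)) (SIGMA i:{1..<r}. {1..i + 1}) \<in> row_families r m"
      unfolding row_families_def by (intro CollectI conjI)
  qed
  show "restrict (\<lambda>(i, j). array_of_family r m n j (i + 1)) (SIGMA i:{1..<r}. {1..i + 1}) = n"
    if n: "n \<in> row_families r m" for n
  proof (rule PiE_ext[where k = "SIGMA i:{1..<r}. {1..i + 1}" and s = "\<lambda>_. UNIV"])
    show "n \<in> (SIGMA i:{1..<r}. {1..i + 1}) \<rightarrow>\<^sub>E UNIV"
      using n by (simp add: row_families_def)
  qed (auto simp: array_of_family_def)
  show "array_of_family r m (restrict (\<lambda>(i, j). a j (i + 1)) (SIGMA i:{1..<r}. {1..i + 1})) = a"
    (is "array_of_family r m ?n = a") if a: "a \<in> column_fibre r m" for a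
  proof (rule PiE_ext[where k = "{1..r}" and s = "\<lambda>j. {j..r} \<rightarrow>\<^sub>E UNIV"])
    show a': "a \<in> (\<Pi>\<^sub>E j\<in>{1..r}. {j..r} \<rightarrow>\<^sub>E UNIV)"
      using a by (simp add: column_fibre_def triangular_arrays_def)
    show "array_of_family r m ?n \<in> (\<Pi>\<^sub>E j\<in>{1..r}. {j..r} \<rightarrow>\<^sub>E UNIV)"
      by (auto simp: array_of_family_def)
    fix j assume j: "j \<in> {1..r}"
    show "array_of_family r m ?n j = a j"
    proof (rule PiE_ext[where k = "{j..r}" and s = "\<lambda>_. UNIV"])
      show "a j \<in> {j..r} \<rightarrow>\<^sub>E UNIV"
        using a' j by blast
      show "array_of_family r m ?n j \<in> {j..r} \<rightarrow>\<^sub>E UNIV"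
        using j by (auto simp: array_of_family_def)
      fix v assume v: "v \<in> {j..r}"
      show "array_of_family r m ?n j v = a j v"
      proof (cases "v = 1")
        case True
        have "1 \<in> {1..r}"
          using True v by simp
        then have "(\<Sum>j=1..1. a j 1) = m 1"
          using a unfolding column_fibre_def by blast
        then show ?thesis
          using True j v by (simp add: array_of_family_def)
      qed (use j v in \<open>auto simp: array_of_family_def\<close>)
    qed
  qed
qed

lemma sum_triangle_swap:
  fixes f :: "nat \<Rightarrow> nat \<Rightarrow> 'a :: comm_monoid_add"
  shows "(\<Sum>j=1..r. \<Sum>v=j..r. f j v) = (\<Sum>v=1..r. \<Sum>j=1..v. f j v)"
proof -
  have "(\<Sum>j=1..r. \<Sum>v=j..r. f j v) = (\<Sum>j=1..r. \<Sum>v\<in>{v \<in> {1..r}. j \<le> v}. f j v)"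
    by (intro sum.cong) auto
  also have "\<dots> = (\<Sum>v=1..r. \<Sum>j\<in>{j \<in> {1..r}. j \<le> v}. f j v)"
    by (rule sum.swap_restrict) auto
  also have "\<dots> = (\<Sum>v=1..r. \<Sum>j=1..v. f j v)"
    by (intro sum.cong) auto
  finally show ?thesis .
qed

lemma prod_triangle_swap:
  fixes f :: "nat \<Rightarrow> nat \<Rightarrow> 'a :: comm_monoid_mult"
  shows "(\<Prod>j=1..r. \<Prod>v=j..r. f j v) = (\<Prod>v=1..r. \<Prod>j=1..v. f j v)"
proof -
  have "(\<Prod>j=1..r. \<Prod>v=j..r. f j v) = (\<Prod>j=1..r. \<Prod>v\<in>{v \<in> {1..r}. j \<le> v}. f j v)"
    by (intro prod.cong) auto
  also have "\<dots> = (\<Prod>v=1..r. \<Prod>j\<in>{j \<in> {1..r}. j \<le> v}. f j v)"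
    by (rule prod.swap_restrict) auto
  also have "\<dots> = (\<Prod>v=1..r. \<Prod>j=1..v. f j v)"
    by (intro prod.cong) auto
  finally show ?thesis .
qed

lemma sum_split_first_shift:
  fixes f :: "nat \<Rightarrow> 'a :: comm_monoid_add"
  assumes "j \<le> r"
  shows "(\<Sum>v=j..r. f v) = f j + (\<Sum>i=j..<r. f (i + 1))"
proof -
  have "(\<Sum>i=j..<r. f (i + 1)) = (\<Sum>v=Suc j..r. f v)"
    by (rule sum.reindex_bij_witness[of _ "\<lambda>v. v - 1" "\<lambda>i. i + 1"]) auto
  then show ?thesis
    using assms by (simp add: sum.atLeast_Suc_atMost)
qed

lemma prod_split_first_shift:
  fixes f :: "nat \<Rightarrow> 'a :: comm_monoid_mult"
  assumes "j \<le> r"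
  shows "(\<Prod>v=j..r. f v) = f j * (\<Prod>i=j..<r. f (i + 1))"
proof -
  have "(\<Prod>i=j..<r. f (i + 1)) = (\<Prod>v=Suc j..r. f v)"
    by (rule prod.reindex_bij_witness[of _ "\<lambda>v. v - 1" "\<lambda>i. i + 1"]) auto
  then show ?thesis
    using assms by (simp add: prod.atLeast_Suc_atMost)
qed

text \<open>
  The diagonal entry is what the other entries of its column leave of \<open>m j\<close>; this is the difference
  in \<open>stirling_top\<close>. The remaining entries of the row are the other sum there.
\<close>

lemma array_of_family_row_sum:
  assumes n: "n \<in> row_families r m" and j: "j \<in> {1..r}"
  shows "(\<Sum>v=j..r. array_of_family r m n j v) = stirling_top r m n j"
proof -
  have "(\<Sum>v=j..r. array_of_family r m n j v) =
      array_of_family r m n j j + (\<Sum>i=j..<r. array_of_family r m n j (i + 1))"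
    using j by (intro sum_split_first_shift) auto
  also have "(\<Sum>i=j..<r. array_of_family r m n j (i + 1)) = (\<Sum>i=j..<r. n (i, j))"
    using j by (intro sum.cong) (auto simp: array_of_family_def)
  also have "array_of_family r m n j j = m j - (\<Sum>i\<in>{1..<j}. n (j - 1, i))"
  proof (cases "j = 1")
    case True
    then show ?thesis using j by (simp add: array_of_family_def)
  next
    case False
    then have "(\<Sum>i=1..j. n (j - 1, i)) = m j"
      using j by (intro row_family_sum[OF n]) auto
    moreover have "{1..j} = insert j {1..<j}"
      using j by auto
    ultimately show ?thesis
      using j False by (auto simp: array_of_family_def)
  qed
  finally show ?thesis
    by (simp add: stirling_top_def)
qed

lemma column_fibre_total:
  assumes "a \<in> column_fibre r m"
  shows "(\<Sum>j=1..r. \<Sum>v=j..r. a j v) = (\<Sum>v=1..r. m v)"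
  unfolding sum_triangle_swap using assms by (intro sum.cong) (auto simp: column_fibre_def)

text \<open>
  Reading the product by columns instead of rows gives, for each \<open>v\<close>, the power of \<open>t v\<close> and
  a multinomial coefficient. The one of the first column is trivial.
\<close>

lemma column_fibre_monomial:
  fixes t :: "nat \<Rightarrow> complex"
  assumes a: "a \<in> column_fibre r m" and "r \<ge> 1"
  shows "(\<Prod>j=1..r. \<Prod>v=j..r. t v ^ a j v / fact (a j v)) =
      (\<Prod>i\<in>{1..<r}. multinomial (m (i + 1)) {1..i + 1} (\<lambda>j. a j (i + 1))) *
      (\<Prod>v=1..r. t v ^ m v / fact (m v))"
proof -
  let ?c = "\<lambda>v. multinomial (m v) {1..v} (\<lambda>j. a j v)"
  have "(\<Prod>j=1..r. \<Prod>v=j..r. t v ^ a j v / fact (a j v)) =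
      (\<Prod>v=1..r. \<Prod>j=1..v. t v ^ a j v / fact (a j v))"
    by (rule prod_triangle_swap)
  also have "\<dots> = (\<Prod>v=1..r. ?c v * (t v ^ m v / fact (m v)))"
  proof (rule prod.cong)
    fix v assume "v \<in> {1..r}"
    then have "(\<Sum>j=1..v. a j v) = m v"
      using a by (auto simp: column_fibre_def)
    then have "(\<Prod>j=1..v. t v ^ a j v) = t v ^ m v"
      by (simp add: power_sum[symmetric])
    then show "(\<Prod>j=1..v. t v ^ a j v / fact (a j v)) = ?c v * (t v ^ m v / fact (m v))"
      by (simp add: prod_dividef multinomial_def)
  qed auto
  also have "\<dots> = (\<Prod>v=1..r. ?c v) * (\<Prod>v=1..r. t v ^ m v / fact (m v))"
    by (rule prod.distrib)
  also have "(\<Prod>v=1..r. ?c v) = ?c 1 * (\<Prod>i=1..<r. ?c (i + 1))"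
    using assms(2) by (rule prod_split_first_shift)
  also have "?c 1 = 1"
  proof -
    have "(\<Sum>j=1..1. a j 1) = m 1"
      using a assms(2) unfolding column_fibre_def by fastforce
    then show ?thesis
      by (simp add: multinomial_def)
  qed
  finally show ?thesis
    by simp
qed

lemma expansion_term_array_of_family:
  assumes n: "n \<in> row_families r m" and "r \<ge> 1"
  shows "expansion_term r t l (array_of_family r m n) =
    (-1) ^ (\<Sum>j=1..r. m j) * ((-1) ^ (\<Sum>j=1..r. l j) * (\<Prod>j=1..r. fact (l j))) *
    ((\<Prod>i\<in>{1..<r}. multinomial (m (i + 1)) {1..i + 1} (\<lambda>j. n (i, j)))
            * (\<Prod>j=1..r. of_nat (Stirling (stirling_top r m n j) (l j)))) *
    (\<Prod>j=1..r. t j ^ m j / fact (m j))"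
proof -
  let ?a = "array_of_family r m n"
  have a: "?a \<in> column_fibre r m"
    using bij_betw_array_of_family n by (auto simp: bij_betw_def)
  have "(\<Sum>j=1..r. stirling_top r m n j) = (\<Sum>j=1..r. \<Sum>v=j..r. ?a j v)"
    by (intro sum.cong array_of_family_row_sum[OF n, symmetric]) auto
  also have "\<dots> = (\<Sum>j=1..r. m j)"
    by (rule column_fibre_total[OF a])
  finally have total: "(\<Sum>j=1..r. stirling_top r m n j) = (\<Sum>j=1..r. m j)" .
  have "(\<Prod>j=1..r. one_minus_exp_coeff (l j) (\<Sum>v=j..r. ?a j v)) =
      (\<Prod>j=1..r. one_minus_exp_coeff (l j) (stirling_top r m n j) :: complex)"
    by (intro prod.cong) (auto simp: array_of_family_row_sum[OF n])
  also have "\<dots> = (-1) ^ ((\<Sum>j=1..r. l j) + (\<Sum>j=1..r. m j)) * (\<Prod>j=1..r. fact (l j)) *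
      (\<Prod>j=1..r. of_nat (Stirling (stirling_top r m n j) (l j)))"
    unfolding one_minus_exp_coeff_def prod.distrib total[symmetric] sum.distrib[symmetric] power_sum ..
  finally have coeff: "(\<Prod>j=1..r. one_minus_exp_coeff (l j) (\<Sum>v=j..r. ?a j v)) =
      (-1) ^ ((\<Sum>j=1..r. l j) + (\<Sum>j=1..r. m j)) * (\<Prod>j=1..r. fact (l j)) *
      (\<Prod>j=1..r. of_nat (Stirling (stirling_top r m n j) (l j)) :: complex)" .
  have "multinomial (m (i + 1)) {1..i + 1} (\<lambda>j. ?a j (i + 1)) =
      multinomial (m (i + 1)) {1..i + 1} (\<lambda>j. n (i, j))" if "i \<in> {1..<r}" for i
    using that unfolding multinomial_def
    by (intro arg_cong2[where f = "(/)"] prod.cong refl) (auto simp: array_of_family_def)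
  then have multinomials: "(\<Prod>i\<in>{1..<r}. multinomial (m (i + 1)) {1..i + 1} (\<lambda>j. ?a j (i + 1))) =
      (\<Prod>i\<in>{1..<r}. multinomial (m (i + 1)) {1..i + 1} (\<lambda>j. n (i, j)))"
    by (intro prod.cong) auto
  show ?thesis
    unfolding expansion_term_def prod.distrib coeff column_fibre_monomial[OF a assms(2)] multinomials
    by (simp add: power_add mult_ac)
qed

lemma finite_column_fibre: "finite (column_fibre r m)"
proof (rule finite_subset)
  show "column_fibre r m \<subseteq> (\<Pi>\<^sub>E j\<in>{1..r}. {j..r} \<rightarrow>\<^sub>E {..\<Sum>v=1..r. m v})"
  proof
    fix a assume a: "a \<in> column_fibre r m"
    have "a j v \<le> (\<Sum>v=1..r. m v)" if "j \<in> {1..r}" "v \<in> {j..r}" for j v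
    proof -
      have "a j v \<le> (\<Sum>v=j..r. a j v)"
        using that by (intro member_le_sum) auto
      also have "\<dots> \<le> (\<Sum>j=1..r. \<Sum>v=j..r. a j v)"
        using that by (intro member_le_sum[of j "{1..r}" "\<lambda>j. \<Sum>v=j..r. a j v"]) auto
      finally show ?thesis
        by (simp only: column_fibre_total[OF a])
    qed
    then show "a \<in> (\<Pi>\<^sub>E j\<in>{1..r}. {j..r} \<rightarrow>\<^sub>E {..\<Sum>v=1..r. m v})"
      using a unfolding column_fibre_def triangular_arrays_def by (simp add: PiE_iff)
  qed
  show "finite (\<Pi>\<^sub>E j\<in>{1..r}. {j..r} \<rightarrow>\<^sub>E {..\<Sum>v=1..r. m v})"
    by (intro finite_PiE) auto
qed

text \<open>
  No row sum exceeds the sum of the whole array, and the Stirling number vanishes when its lower entry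
  exceeds its upper one. This bounds the range of the \<open>l j\<close> in the closed formula.
\<close>

lemma expansion_term_column_fibre_zero:
  assumes a: "a \<in> column_fibre r m" and j: "j \<in> {1..r}" and "l j > (\<Sum>v=1..r. m v)"
  shows "expansion_term r t l a = 0"
proof -
  have "(\<Sum>v=j..r. a j v) \<le> (\<Sum>j=1..r. \<Sum>v=j..r. a j v)"
    using j by (intro member_le_sum[of j "{1..r}" "\<lambda>j. \<Sum>v=j..r. a j v"]) auto
  then have "(\<Sum>v=j..r. a j v) < l j"
    using assms(3) by (simp only: column_fibre_total[OF a])
  then have "one_minus_exp_coeff (l j) (\<Sum>v=j..r. a j v) = (0 :: complex)"
    by (simp add: one_minus_exp_coeff_def)
  then show ?thesis
    unfolding expansion_term_def using j by (intro prod_zero) auto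
qed

section \<open>The closed formula\<close>

text \<open>
  The column sums fix the monomial, so it is a common factor of all these terms. Only finitely many of
  them are nonzero, and their sum is reindexed by the families \<open>n\<close>.
\<close>

lemma column_fibre_has_sum:
  assumes "r \<ge> 1"
  shows "((\<lambda>(l, a). expansion_term r t l a / gap_weight r k l) has_sum
           closed_formula r k m * (\<Prod>j=1..r. t j ^ m j / fact (m j)))
           (multi_indices r \<times> column_fibre r m)"
proof (rule has_sum_finite_neutralI)
  let ?box = "{1..r} \<rightarrow>\<^sub>E {0..\<Sum>j=1..r. m j}"
  let ?F = "\<lambda>(l, a). expansion_term r t l a / gap_weight r k l"
  show "finite (?box \<times> column_fibre r m)"
    by (intro finite_cartesian_product finite_PiE finite_column_fibre) auto
  show "?box \<times> column_fibre r m \<subseteq> multi_indices r \<times> column_fibre r m"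
    by (auto simp: multi_indices_def)
  show "?F x = 0" if "x \<in> multi_indices r \<times> column_fibre r m - ?box \<times> column_fibre r m" for x
  proof -
    obtain l a where "x = (l, a)"
      by (cases x)
    with that have x: "x = (l, a)" "a \<in> column_fibre r m" "l \<in> multi_indices r" "l \<notin> ?box"
      by auto
    then obtain j where "j \<in> {1..r}" "l j > (\<Sum>v=1..r. m v)"
      by (auto simp: multi_indices_def PiE_iff)
    then show ?thesis
      using expansion_term_column_fibre_zero x by auto
  qed
  let ?X = "\<lambda>l n. (\<Prod>i\<in>{1..<r}. multinomial (m (i + 1)) {1..i + 1} (\<lambda>j. n (i, j)))
            * (\<Prod>j=1..r. of_nat (Stirling (stirling_top r m n j) (l j)))"
  have "(\<Sum>a\<in>column_fibre r m. expansion_term r t l a / gap_weight r k l) =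
      (-1) ^ (\<Sum>j=1..r. m j) * (((-1) ^ (\<Sum>j=1..r. l j) * (\<Prod>j=1..r. fact (l j)))
         / gap_weight r k l * (\<Sum>n \<in> row_families r m. ?X l n)) *
      (\<Prod>j=1..r. t j ^ m j / fact (m j))" for l
  proof -
    have "(\<Sum>a\<in>column_fibre r m. expansion_term r t l a / gap_weight r k l) =
        (\<Sum>n\<in>row_families r m. expansion_term r t l (array_of_family r m n) / gap_weight r k l)"
      by (rule sum.reindex_bij_betw[OF bij_betw_array_of_family, symmetric])
    also have "\<dots> = (\<Sum>n\<in>row_families r m.
        (-1) ^ (\<Sum>j=1..r. m j) * (((-1) ^ (\<Sum>j=1..r. l j) * (\<Prod>j=1..r. fact (l j)))
           / gap_weight r k l * ?X l n) * (\<Prod>j=1..r. t j ^ m j / fact (m j)))"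
      by (intro sum.cong refl)
         (simp only: expansion_term_array_of_family[OF _ assms] times_divide_eq_left
            times_divide_eq_right mult_ac)
    finally show ?thesis
      by (simp only: sum_distrib_left sum_distrib_right)
  qed
  then show "closed_formula r k m * (\<Prod>j=1..r. t j ^ m j / fact (m j)) =
      sum ?F (?box \<times> column_fibre r m)"
    unfolding closed_formula_def gap_weight_def sum.cartesian_product[symmetric]
    by (simp only: sum_distrib_left sum_distrib_right)
qed

lemma bij_betw_column_sums:
  "bij_betw (\<lambda>(l, a). (\<lambda>v\<in>{1..r}. \<Sum>j=1..v. a j v, l, a)) (multi_indices r \<times> triangular_arrays r)
     (SIGMA m:multi_indices r. multi_indices r \<times> column_fibre r m)"
proof (rule bij_betwI[where g = snd])
  show "(\<lambda>(l, a). (\<lambda>v\<in>{1..r}. \<Sum>j=1..v. a j v, l, a)) (snd x) = x"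
    if "x \<in> (SIGMA m:multi_indices r. multi_indices r \<times> column_fibre r m)" for x
  proof -
    obtain m l a where "x = (m, l, a)"
      by (cases x rule: prod_cases3)
    with that have x: "x = (m, l, a)" "m \<in> multi_indices r" "a \<in> column_fibre r m"
      by auto
    have "(\<lambda>v\<in>{1..r}. \<Sum>j=1..v. a j v) = m"
      by (rule PiE_ext[where k = "{1..r}" and s = "\<lambda>_. UNIV"])
         (use x in \<open>auto simp: multi_indices_def column_fibre_def\<close>)
    then show ?thesis
      by (simp add: x)
  qed
qed (auto simp: multi_indices_def column_fibre_def)

lemma poly_bernoulli_expansion_closed_formula:
  assumes "r \<ge> 1"
  shows "poly_bernoulli_expansion r k (restrict (closed_formula r k) (multi_indices r))"
  unfolding poly_bernoulli_expansion_def
proof (intro exI[of _ "expansion_radius r"] conjI allI impI expansion_radius_pos assms)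
  fix t :: "nat \<Rightarrow> complex"
  assume t: "\<forall>j\<in>{1..r}. norm (t j) < expansion_radius r \<and> one_minus_exp r t j \<noteq> 0"
  let ?S = "Li_sh r k (one_minus_exp r t) / (\<Prod>j=1..r. one_minus_exp r t j)"
  let ?F = "\<lambda>(l, a). expansion_term r t l a / gap_weight r k l"
  have "(?F has_sum ?S) (multi_indices r \<times> triangular_arrays r)"
    using t by (intro Li_sh_quotient_has_sum) auto
  then have "((\<lambda>(m, x). ?F x) has_sum ?S) (SIGMA m:multi_indices r. multi_indices r \<times> column_fibre r m)"
    using has_sum_reindex_bij_betw[OF bij_betw_column_sums, where f = "\<lambda>(m, x). ?F x" and S = ?S]
    by (simp add: case_prod_unfold)
  then have "((\<lambda>m. closed_formula r k m * (\<Prod>j=1..r. t j ^ m j / fact (m j))) has_sum ?S)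
      (multi_indices r)"
    by (rule has_sum_SigmaD) (simp only: prod.case column_fibre_has_sum[OF assms])
  then show "((\<lambda>m. restrict (closed_formula r k) (multi_indices r) m *
      (\<Prod>j=1..r. t j ^ m j / fact (m j))) has_sum ?S) (multi_indices r)"
    by (rule has_sum_cong[THEN iffD1, rotated]) simp
qed

lemma closed_formula_restrict:
  "closed_formula r k (restrict m {1..r}) = closed_formula r k m"
proof -
  let ?m = "restrict m {1..r}"
  have sums: "(\<Sum>j=1..r. ?m j) = (\<Sum>j=1..r. m j)"
    by (intro sum.cong) auto
  have rows: "row_families r ?m = row_families r m"
    unfolding row_families_def by (intro Collect_cong conj_cong ball_cong refl) auto
  have tops: "(\<Prod>j=1..r. of_nat (Stirling (stirling_top r ?m n j) (l j))) =
      (\<Prod>j=1..r. of_nat (Stirling (stirling_top r m n j) (l j)) :: complex)" for n l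
    by (intro prod.cong) (auto simp: stirling_top_def)
  have multinomials: "(\<Prod>i\<in>{1..<r}. multinomial (?m (i + 1)) {1..i + 1} (\<lambda>j. n (i, j))) =
      (\<Prod>i\<in>{1..<r}. multinomial (m (i + 1)) {1..i + 1} (\<lambda>j. n (i, j)))" for n
    by (intro prod.cong) auto
  show ?thesis
    unfolding closed_formula_def sums rows tops multinomials ..
qed

theorem theorem1p8:
  fixes r :: nat and k :: "nat \<Rightarrow> int" and m :: "nat \<Rightarrow> nat"
  assumes "r \<ge> 1"
  shows "poly_bernoulli r k m =
    (-1) ^ (\<Sum>j=1..r. m j) *
    (\<Sum>l \<in> {1..r} \<rightarrow>\<^sub>E {0..(\<Sum>j=1..r. m j)}.
       ((-1) ^ (\<Sum>j=1..r. l j) * (\<Prod>j=1..r. fact (l j)))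
         / (\<Prod>j=1..r. of_nat ((\<Sum>i=1..j. l i) + j) powi k j)
       * (\<Sum>n \<in> row_families r m.
            (\<Prod>i\<in>{1..<r}. multinomial (m (i + 1)) {1..i + 1} (\<lambda>j. n (i, j)))
            * (\<Prod>j=1..r. of_nat (Stirling (stirling_top r m n j) (l j)))))"
proof -
  let ?B = "restrict (closed_formula r k) (multi_indices r)"
  \<comment> \<open>The defining description selects the coefficient family off whose index set the value is \<open>undefined\<close>.\<close>
  have "(THE B. B \<in> extensional (multi_indices r) \<and> poly_bernoulli_expansion r k B) = ?B"
  proof (rule the_equality)
    show "?B \<in> extensional (multi_indices r) \<and> poly_bernoulli_expansion r k ?B"
      using poly_bernoulli_expansion_closed_formula[OF assms] by simp
    fix B assume "B \<in> extensional (multi_indices r) \<and> poly_bernoulli_expansion r k B"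
    then show "B = ?B"
      using poly_bernoulli_expansion_unique[OF _ poly_bernoulli_expansion_closed_formula[OF assms]]
      by (intro extensionalityI[of _ "multi_indices r"]) auto
  qed
  moreover have "restrict m {1..r} \<in> multi_indices r"
    by (auto simp: multi_indices_def)
  ultimately have "poly_bernoulli r k m = closed_formula r k m"
    by (simp only: poly_bernoulli_def restrict_apply' closed_formula_restrict)
  then show ?thesis
    unfolding closed_formula_def .
qed

end
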